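(* Let $q\in\mathbb{N}$, let $T$ be a $(q+1)$-homogeneous tree rooted at $o$, let $\phi:T\to T$ be a self map and let $1\le p\le\infty$. Then the following are equivalent: (a) $C_\phi$ is compact on $\mathbb{T}_p$. (b) $\|C_\phi f_n\|_p\to 0$ as $n\to\infty$ whenever $\{f_n\}$ is a bounded sequence in $\mathbb{T}_p$ that converges to $0$ pointwise on $T$.
   Context: $\mathbb{N}=\{1,2,\ldots\}$, $\mathbb{N}_0=\mathbb{N}\cup\{0\}$. A $(q+1)$-homogeneous tree is an (infinite) connected graph without cycles in which every vertex has exactly $q+1$ neighbours; it is rooted at a fixed vertex $o$. We identify $T$ with its vertex set, and $|v|$ denotes the number of edges in the unique path from $o$ to $v$. A self map of $T$ is an arbitrary function $\phi:T\to T$ on vertices. For $f:T\to\mathbb{C}$ put $M_p(0,f)=|f(o)|$ and, for $n\in\mathbb{N}$, $M_p(n,f)=\left(\frac{1}{(q+1)q^{n-1}}\sum_{|v|=n}|f(v)|^p\right)^{1/p}$ if $p<\infty$ and $M_\infty(n,f)=\max_{|v|=n}|f(v)|$. Let $\|f\|_p=\sup_{n\in\mathbb{N}_0}M_p(n,f)\in[0,\infty]$ and $\mathbb{T}_p=\{f:T\to\mathbb{C} : \|f\|_p<\infty\}$, a Banach space under $\|\cdot\|_p$. The composition operator is $C_\phi f=f\circ\phi$ (in (b), $\|C_\phi f_n\|_p$ is a priori an element of $[0,\infty]$). $C_\phi$ is compact on $\mathbb{T}_p$ if it is a bounded linear operator from $\mathbb{T}_p$ to itself and the image $\{C_\phi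 f : \|f\|_p\le 1\}$ of the closed unit ball has compact closure in $\mathbb{T}_p$. *)

theory Defs
  imports "HOL-Analysis.Analysis"
begin

text \<open>
  A simple graph is given by its adjacency relation; its vertex set is the whole
  (arbitrary) type \<open>'v\<close>.  A path is the list of its vertices.
\<close>

definition graph_path :: "('v \<Rightarrow> 'v \<Rightarrow> bool) \<Rightarrow> 'v \<Rightarrow> 'v list \<Rightarrow> 'v \<Rightarrow> bool" where
  "graph_path adj u xs v \<longleftrightarrow>
     xs \<noteq> [] \<and> hd xs = u \<and> last xs = v \<and> distinct xs \<and> successively adj xs"

definition graph_cycle :: "('v \<Rightarrow> 'v \<Rightarrow> bool) \<Rightarrow> 'v list \<Rightarrow> bool" where
  "graph_cycle adj xs \<longleftrightarrow>
     length xs \<ge> 3 \<and> distinct xs \<and> successively adj xs \<and> adj (last xs) (hd xs)"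

text \<open>
  \<open>card\<close> of an infinite set is \<open>0\<close>, so the degree condition includes local finiteness.
\<close>

definition homogeneous_tree :: "nat \<Rightarrow> ('v \<Rightarrow> 'v \<Rightarrow> bool) \<Rightarrow> bool" where
  "homogeneous_tree q adj \<longleftrightarrow>
     infinite (UNIV :: 'v set) \<and>
     symp adj \<and> irreflp adj \<and>
     (\<forall>u v. \<exists>xs. graph_path adj u xs v) \<and>
     (\<nexists>xs. graph_cycle adj xs) \<and>
     (\<forall>v. card {w. adj v w} = q + 1)"

definition tree_level :: "('v \<Rightarrow> 'v \<Rightarrow> bool) \<Rightarrow> 'v \<Rightarrow> 'v \<Rightarrow> nat" where
  "tree_level adj r v = length (THE xs. graph_path adj r xs v) - 1"

definition tree_mean ::
  "nat \<Rightarrow> ('v \<Rightarrow> 'v \<Rightarrow> bool) \<Rightarrow> 'v \<Rightarrow> ennreal \<Rightarrow> nat \<Rightarrow> ('v \<Rightarrow> complex) \<Rightarrow> real" where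
  "tree_mean q adj r p n f =
     (if n = 0 then cmod (f r)
      else if p = \<infinity> then Max ((\<lambda>v. cmod (f v)) ` {v. tree_level adj r v = n})
      else (1 / ((real q + 1) * real q ^ (n - 1)) *
            (\<Sum>v | tree_level adj r v = n. cmod (f v) powr enn2real p)) powr (1 / enn2real p))"

definition tree_norm ::
  "nat \<Rightarrow> ('v \<Rightarrow> 'v \<Rightarrow> bool) \<Rightarrow> 'v \<Rightarrow> ennreal \<Rightarrow> ('v \<Rightarrow> complex) \<Rightarrow> ennreal" where
  "tree_norm q adj r p f = (SUP n. ennreal (tree_mean q adj r p n f))"

definition tree_space ::
  "nat \<Rightarrow> ('v \<Rightarrow> 'v \<Rightarrow> bool) \<Rightarrow> 'v \<Rightarrow> ennreal \<Rightarrow> ('v \<Rightarrow> complex) set" where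
  "tree_space q adj r p = {f. tree_norm q adj r p f < \<infinity>}"

definition tree_dist ::
  "nat \<Rightarrow> ('v \<Rightarrow> 'v \<Rightarrow> bool) \<Rightarrow> 'v \<Rightarrow> ennreal \<Rightarrow> ('v \<Rightarrow> complex) \<Rightarrow> ('v \<Rightarrow> complex) \<Rightarrow> real" where
  "tree_dist q adj r p f g = enn2real (tree_norm q adj r p (\<lambda>v. f v - g v))"

definition tree_topology ::
  "nat \<Rightarrow> ('v \<Rightarrow> 'v \<Rightarrow> bool) \<Rightarrow> 'v \<Rightarrow> ennreal \<Rightarrow> ('v \<Rightarrow> complex) topology" where
  "tree_topology q adj r p =
     Metric_space.mtopology (tree_space q adj r p) (tree_dist q adj r p)"

definition bounded_operator_on_tree_space ::
  "nat \<Rightarrow> ('v \<Rightarrow> 'v \<Rightarrow> bool) \<Rightarrow> 'v \<Rightarrow> ennreal \<Rightarrow>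
    (('v \<Rightarrow> complex) \<Rightarrow> ('v \<Rightarrow> complex)) \<Rightarrow> bool" where
  "bounded_operator_on_tree_space q adj r p A \<longleftrightarrow>
     A ` tree_space q adj r p \<subseteq> tree_space q adj r p \<and>
     (\<forall>f\<in>tree_space q adj r p. \<forall>g\<in>tree_space q adj r p.
        A (\<lambda>v. f v + g v) = (\<lambda>v. A f v + A g v)) \<and>
     (\<forall>c. \<forall>f\<in>tree_space q adj r p. A (\<lambda>v. c * f v) = (\<lambda>v. c * A f v)) \<and>
     (\<exists>K::real. \<forall>f\<in>tree_space q adj r p.
        tree_norm q adj r p (A f) \<le> ennreal K * tree_norm q adj r p f)"

definition compact_operator_on_tree_space ::
  "nat \<Rightarrow> ('v \<Rightarrow> 'v \<Rightarrow> bool) \<Rightarrow> 'v \<Rightarrow> ennreal \<Rightarrow>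
    (('v \<Rightarrow> complex) \<Rightarrow> ('v \<Rightarrow> complex)) \<Rightarrow> bool" where
  "compact_operator_on_tree_space q adj r p A \<longleftrightarrow>
     bounded_operator_on_tree_space q adj r p A \<and>
     compactin (tree_topology q adj r p)
       (tree_topology q adj r p closure_of (A ` {f. tree_norm q adj r p f \<le> 1}))"

definition composition_operator :: "('v \<Rightarrow> 'v) \<Rightarrow> ('v \<Rightarrow> complex) \<Rightarrow> ('v \<Rightarrow> complex)" where
  "composition_operator \<phi> f = f \<circ> \<phi>"

end

theory Submission
  imports Defs "HOL-Complex_Analysis.Great_Picard"
begin

text \<open>
  Only five properties of the norm matter: it is homogeneous and subadditive, every point
  evaluation is bounded by it, its balls are closed under pointwise limits, and the underlying
  set is countable. If (b) holds, then \<open>C\<^sub>\<phi>\<close> is bounded, since otherwise rescaling a sequence of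
  counterexamples gives norms tending to \<open>0\<close> whose images are unbounded; and a
  sequence in the unit ball has, by a diagonal argument, a subsequence converging pointwise
  to some \<open>f\<close> in the unit ball, so that (b) applied to the differences shows that the image of the
  ball is sequentially compact. Conversely, if (a) holds, every subsequence of \<open>C\<^sub>\<phi> f\<^sub>n\<close> has a
  norm-convergent further subsequence, whose limit is also the pointwise limit, that is \<open>0\<close>.
\<close>

subsection \<open>Norms dominating point evaluations\<close>

text \<open>\<open>N\<close> is defined on all functions, with value \<open>\<infinity>\<close>
  allowed, so no membership has to be tracked before (b) is stated. In \<open>scale\<close>, the
  case of factor 0 and infinite norm uses that 0 times infinity is 0 in \<open>ennreal\<close>. The
  constant in \<open>eval_bound\<close> may depend on the point but not on the function.\<close>

locale function_norm =
  fixes N :: "('v \<Rightarrow> complex) \<Rightarrow> ennreal"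
  assumes countable_domain: "countable (UNIV :: 'v set)"
    and scale: "N (\<lambda>v. c * f v) = ennreal (cmod c) * N f"
    and triangle: "N (\<lambda>v. f v + g v) \<le> N f + N g"
    and eval_bound: "\<exists>C>0. \<forall>f. ennreal (cmod (f v)) \<le> ennreal C * N f"
    and fatou: "\<lbrakk>\<And>k :: nat. N (F k) \<le> B; \<And>v. (\<lambda>k. F k v) \<longlonglongrightarrow> f v\<rbrakk> \<Longrightarrow> N f \<le> B"
begin

section \<open>The metric space of functions of finite norm\<close>

definition norm_space :: "('v \<Rightarrow> complex) set" where
  "norm_space = {f. N f < \<infinity>}"

definition norm_dist :: "('v \<Rightarrow> complex) \<Rightarrow> ('v \<Rightarrow> complex) \<Rightarrow> real" where
  "norm_dist f g = enn2real (N (\<lambda>v. f v - g v))"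

lemma norm_zero [simp]: "N (\<lambda>v. 0) = 0"
  using scale[of 0 "\<lambda>v. 0"] by simp

lemma norm_diff: "N (\<lambda>v. f v - g v) \<le> N f + N g"
  using triangle[of f "\<lambda>v. (-1) * g v"] scale[of "-1" g] by simp

lemma norm_diff_commute: "N (\<lambda>v. f v - g v) = N (\<lambda>v. g v - f v)"
  using scale[of "-1" "\<lambda>v. f v - g v"] by simp

lemma norm_eq_0D: assumes "N f = 0" shows "f v = 0"
proof -
  obtain C where "ennreal (cmod (f v)) \<le> ennreal C * N f"
    using eval_bound by blast
  then show ?thesis using assms by simp
qed

lemma diff_norm_space: "f \<in> norm_space \<Longrightarrow> g \<in> norm_space \<Longrightarrow> N (\<lambda>v. f v - g v) < \<infinity>"
  unfolding norm_space_def using norm_diff[of f g] by (auto simp: order_le_less_trans)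

text \<open>By \<open>eval_bound\<close> each value is squeezed by a fixed multiple of the norm.
  This later identifies a norm limit with the pointwise limit.\<close>

lemma pointwise_tendsto_0:
  assumes "(\<lambda>n. N (G n)) \<longlonglongrightarrow> 0"
  shows "(\<lambda>n. G n v) \<longlonglongrightarrow> 0"
proof -
  obtain C where C: "\<And>f. ennreal (cmod (f v)) \<le> ennreal C * N f"
    using eval_bound by blast
  have "(\<lambda>n. ennreal C * N (G n)) \<longlonglongrightarrow> ennreal C * 0"
    by (intro tendsto_mult_ennreal tendsto_const assms) auto
  then have "(\<lambda>n. ennreal C * N (G n)) \<longlonglongrightarrow> 0" by simp
  then have "(\<lambda>n. ennreal (cmod (G n v))) \<longlonglongrightarrow> 0"
    by (rule tendsto_sandwich[OF _ _ tendsto_const, rotated 2]) (simp_all add: C)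
  then have "(\<lambda>n. cmod (G n v)) \<longlonglongrightarrow> 0"
    by (subst (asm) ennreal_0[symmetric], subst (asm) tendsto_ennreal_iff) auto
  then show ?thesis by (rule tendsto_norm_zero_cancel)
qed

sublocale met: Metric_space norm_space norm_dist
proof
  show "0 \<le> norm_dist x y" for x y by (simp add: norm_dist_def)
  show "norm_dist x y = norm_dist y x" for x y unfolding norm_dist_def by (subst norm_diff_commute) simp
  show "norm_dist x y = 0 \<longleftrightarrow> x = y" if "x \<in> norm_space" "y \<in> norm_space" for x y
  proof
    assume "norm_dist x y = 0"
    \<comment> \<open>\<open>enn2real\<close> also sends infinity to 0; that case is excluded
      because differences in \<open>norm_space\<close> have finite norm.\<close>
    then have "N (\<lambda>v. x v - y v) = 0"
      using diff_norm_space[OF that] by (auto simp: norm_dist_def enn2real_eq_0_iff)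
    from norm_eq_0D[OF this] show "x = y" by (auto simp: fun_eq_iff)
  qed (simp add: norm_dist_def)
  show "norm_dist x z \<le> norm_dist x y + norm_dist y z" if "x \<in> norm_space" "y \<in> norm_space" "z \<in> norm_space" for x y z
  proof -
    have "N (\<lambda>v. x v - z v) \<le> N (\<lambda>v. x v - y v) + N (\<lambda>v. y v - z v)"
      using triangle[of "\<lambda>v. x v - y v" "\<lambda>v. y v - z v"] by simp
    then have "norm_dist x z \<le> enn2real (N (\<lambda>v. x v - y v) + N (\<lambda>v. y v - z v))"
      unfolding norm_dist_def using diff_norm_space that by (intro enn2real_mono) auto
    also have "\<dots> = norm_dist x y + norm_dist y z"
      unfolding norm_dist_def using diff_norm_space that by (intro enn2real_plus) auto
    finally show ?thesis .
  qed
qed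

text \<open>On \<open>norm_space\<close> the passage through \<open>enn2real\<close> loses nothing,
  so convergence can be argued in \<open>ennreal\<close> from here on.\<close>

lemma limitin_iff:
  assumes "\<And>n. G n \<in> norm_space" "g \<in> norm_space"
  shows "limitin met.mtopology G g sequentially \<longleftrightarrow> (\<lambda>n. N (\<lambda>v. G n v - g v)) \<longlonglongrightarrow> 0"
proof -
  have "ennreal (norm_dist (G n) g) = N (\<lambda>v. G n v - g v)" for n
    unfolding norm_dist_def using diff_norm_space assms by simp
  then have "(\<lambda>n. N (\<lambda>v. G n v - g v)) = (\<lambda>n. ennreal (norm_dist (G n) g))" by simp
  moreover have "(\<lambda>n. ennreal (norm_dist (G n) g)) \<longlonglongrightarrow> 0 \<longleftrightarrow> (\<lambda>n. norm_dist (G n) g) \<longlonglongrightarrow> 0"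
    by (subst ennreal_0[symmetric], subst tendsto_ennreal_iff) (auto simp: norm_dist_def)
  ultimately show ?thesis
    using assms by (simp add: met.limitin_metric_dist_null)
qed

lemma bounded_sequence_pointwise_convergent_subsequence:
  assumes "\<And>n :: nat. N (F n) \<le> 1"
  obtains k f where "strict_mono (k :: nat \<Rightarrow> nat)" "\<And>v. (\<lambda>n. F (k n) v) \<longlonglongrightarrow> f v"
proof -
  obtain C where C: "\<And>v. C v > 0" "\<And>v f. ennreal (cmod (f v)) \<le> ennreal (C v) * N f"
    using eval_bound by metis
  have "cmod (F n v) \<le> C v" for n v
  proof -
    have "ennreal (cmod (F n v)) \<le> ennreal (C v) * 1"
      using C(2) assms by (meson mult_left_mono order_trans zero_le)
    then show ?thesis using C(1)[of v] by (simp add: ennreal_le_iff)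
  qed
  \<comment> \<open>The diagonal argument \<open>function_convergent_subsequence\<close> takes one
    bound for all points, so the values at \<open>v\<close> are divided by their own bound
    \<open>C v\<close> and multiplied back afterwards.\<close>
  then have "cmod (F n v / complex_of_real (C v)) \<le> 1" for n v
    using C(1)[of v] by (simp add: norm_divide)
  then obtain k where k: "strict_mono (k :: nat \<Rightarrow> nat)"
      "\<And>v. \<exists>l. (\<lambda>n. F (k n) v / complex_of_real (C v)) \<longlonglongrightarrow> l"
    using function_convergent_subsequence[OF countable_domain, of "\<lambda>n v. F n v / complex_of_real (C v)" 1]
    by (metis UNIV_I)
  have "\<exists>l. (\<lambda>n. F (k n) v) \<longlonglongrightarrow> l" for v
  proof -
    obtain l where "(\<lambda>n. F (k n) v / complex_of_real (C v)) \<longlonglongrightarrow> l" using k(2) by blast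
    from tendsto_mult_right[OF this, of "complex_of_real (C v)"]
    show ?thesis using C(1)[of v] by auto
  qed
  then show ?thesis using k(1) that by metis
qed

section \<open>Compactness of composition for an abstract norm\<close>

text \<open>Condition (b) for an abstract norm. Taking \<open>K\<close> real makes the common bound
  finite, while the norms of the images may be infinite.\<close>

definition vanishing :: "('v \<Rightarrow> 'v) \<Rightarrow> bool" where
  "vanishing \<phi> \<longleftrightarrow> (\<forall>F :: nat \<Rightarrow> 'v \<Rightarrow> complex.
       (\<exists>K::real. \<forall>n. N (F n) \<le> ennreal K) \<and> (\<forall>v. (\<lambda>n. F n v) \<longlonglongrightarrow> 0) \<longrightarrow>
       (\<lambda>n. N (F n \<circ> \<phi>)) \<longlonglongrightarrow> 0)"

lemma vanishing_imp_bounded: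
  assumes "vanishing \<phi>"
  obtains K :: real where "\<And>f. f \<in> norm_space \<Longrightarrow> N (f \<circ> \<phi>) \<le> ennreal K * N f"
proof (rule ccontr)
  assume "\<not> thesis"
  then have "\<And>K::real. \<exists>f\<in>norm_space. ennreal K * N f < N (f \<circ> \<phi>)"
    using that by (meson not_le)
  \<comment> \<open>The square leaves room for both demands: one factor \<open>n + 1\<close> makes
    the rescaled norms tend to 0, the other makes the norms of their images grow.\<close>
  then have "\<forall>n::nat. \<exists>f\<in>norm_space. ennreal ((real n + 1)\<^sup>2) * N f < N (f \<circ> \<phi>)" by blast
  then obtain f where f: "\<And>n::nat. f n \<in> norm_space"
    "\<And>n. ennreal ((real n + 1)\<^sup>2) * N (f n) < N (f n \<circ> \<phi>)" by metis
  define a where "a n = enn2real (N (f n))" for n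
  have Na: "N (f n) = ennreal (a n)" for n
    using f(1)[of n] by (simp add: a_def norm_space_def)
  \<comment> \<open>A function of norm 0 is the zero function, whose image is zero too, against the
    strict inequality.\<close>
  have apos: "a n > 0" for n
  proof (rule ccontr)
    assume "\<not> 0 < a n"
    then have "N (f n) = 0" by (simp add: Na ennreal_neg)
    then have "f n = (\<lambda>v. 0)" using norm_eq_0D by blast
    then have "f n \<circ> \<phi> = (\<lambda>v. 0)" by auto
    then show False using f(2)[of n] by simp
  qed
  define c where "c n = 1 / ((real n + 1) * a n)" for n
  have cpos: "c n > 0" for n using apos[of n] by (simp add: c_def)
  define G where "G n = (\<lambda>v. complex_of_real (c n) * f n v)" for n
  have NG: "N (G n) = ennreal (1 / (real n + 1))" for n
    using apos[of n] cpos[of n]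
    by (simp add: G_def scale Na flip: ennreal_mult) (simp add: c_def)
  have lim: "(\<lambda>n. N (G n)) \<longlonglongrightarrow> 0"
  proof -
    have "(\<lambda>n. 1 / (real n + 1)) \<longlonglongrightarrow> 0"
      using LIMSEQ_inverse_real_of_nat by (simp add: field_simps)
    from tendsto_ennrealI[OF this] show ?thesis by (simp add: NG)
  qed
  have "N (G n) \<le> ennreal 1" for n unfolding NG by (rule ennreal_leI) simp
  then have "(\<lambda>n. N (G n \<circ> \<phi>)) \<longlonglongrightarrow> 0"
    using assms pointwise_tendsto_0[OF lim] unfolding vanishing_def by blast
  then have "eventually (\<lambda>n. N (G n \<circ> \<phi>) < 1) sequentially"
    by (rule order_tendstoD) simp
  then obtain n where n: "N (G n \<circ> \<phi>) < 1" by (auto simp: eventually_sequentially)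
  \<comment> \<open>The image of \<open>G n\<close> has norm at least \<open>n + 1\<close> for every
    \<open>n\<close>, which contradicts the choice of \<open>n\<close>.\<close>
  have "1 \<le> ennreal (real n + 1)" by simp
  also have "\<dots> = ennreal (c n) * (ennreal ((real n + 1)\<^sup>2) * N (f n))"
    using apos[of n] cpos[of n]
    by (simp add: Na flip: ennreal_mult) (simp add: c_def power2_eq_square)
  also have "\<dots> \<le> ennreal (c n) * N (f n \<circ> \<phi>)"
    using f(2)[of n] by (intro mult_left_mono) auto
  also have "\<dots> = N (G n \<circ> \<phi>)"
    using scale[of "complex_of_real (c n)" "f n \<circ> \<phi>"] cpos[of n] by (simp add: G_def o_def)
  finally show False using n by simp
qed

lemma vanishing_imp_compact:
  assumes "vanishing \<phi>"
  shows "compactin met.mtopology (met.mtopology closure_of ((\<lambda>f. f \<circ> \<phi>) ` {f. N f \<le> 1}))"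
proof -
  let ?S = "(\<lambda>f. f \<circ> \<phi>) ` {f. N f \<le> 1}"
  obtain K where K: "\<And>f. f \<in> norm_space \<Longrightarrow> N (f \<circ> \<phi>) \<le> ennreal K * N f"
    using vanishing_imp_bounded[OF assms] by blast
  have S: "f \<circ> \<phi> \<in> norm_space" if "N f \<le> 1" for f
  proof -
    have fin: "N f < \<infinity>" using that by (simp add: order_le_less_trans)
    then have "N (f \<circ> \<phi>) \<le> ennreal K * N f" using K by (simp add: norm_space_def)
    also have "\<dots> < \<infinity>" using fin by (simp add: ennreal_mult_less_top)
    finally show ?thesis by (simp add: norm_space_def)
  qed
  \<comment> \<open>The image itself is compact, hence closed in a Hausdorff space and equal to its
    closure.\<close>
  have "compactin met.mtopology ?S"
    unfolding met.compactin_sequentially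
  proof (intro conjI allI impI)
    show "?S \<subseteq> norm_space" using S by auto
    fix \<sigma> :: "nat \<Rightarrow> 'v \<Rightarrow> complex"
    assume "range \<sigma> \<subseteq> ?S"
    then have "\<forall>n. \<exists>f. N f \<le> 1 \<and> \<sigma> n = f \<circ> \<phi>" by auto
    then obtain F where F: "\<And>n. N (F n) \<le> 1" "\<And>n. \<sigma> n = F n \<circ> \<phi>" by metis
    obtain k f where k: "strict_mono (k :: nat \<Rightarrow> nat)" "\<And>v. (\<lambda>n. F (k n) v) \<longlonglongrightarrow> f v"
      using bounded_sequence_pointwise_convergent_subsequence[of F] F(1) by blast
    \<comment> \<open>Keeping the pointwise limit in the unit ball places the limit of the images
      back in \<open>?S\<close>.\<close>
    have f: "N f \<le> 1" using fatou[of "\<lambda>n. F (k n)" 1 f] F(1) k(2) by blast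
    have "N (\<lambda>v. F (k n) v - f v) \<le> ennreal 2" for n
    proof -
      have "N (\<lambda>v. F (k n) v - f v) \<le> N (F (k n)) + N f" by (rule norm_diff)
      also have "\<dots> \<le> 1 + 1" using F(1) f by (intro add_mono) auto
      finally show ?thesis by simp
    qed
    moreover have "(\<lambda>n. F (k n) v - f v) \<longlonglongrightarrow> 0" for v
      using k(2) by (simp add: LIM_zero)
    ultimately have "(\<lambda>n. N ((\<lambda>v. F (k n) v - f v) \<circ> \<phi>)) \<longlonglongrightarrow> 0"
      using assms[unfolded vanishing_def, rule_format, of "\<lambda>n v. F (k n) v - f v"] by blast
    then have "limitin met.mtopology (\<sigma> \<circ> k) (f \<circ> \<phi>) sequentially"
      using S f F by (subst limitin_iff) (auto simp: o_def)
    then show "\<exists>l r. l \<in> ?S \<and> strict_mono r \<and> limitin met.mtopology (\<sigma> \<circ> r) l sequentially"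
      using k(1) f by blast
  qed
  then show ?thesis
    using compactin_imp_closedin[OF met.Hausdorff_space_mtopology] closure_of_closedin by metis
qed

text \<open>From boundedness of the operator only the invariance of \<open>norm_space\<close>
  enters, as \<open>bdd\<close>. It makes the images points of the metric space.\<close>

lemma compact_imp_vanishing:
  assumes bdd: "\<And>f. f \<in> norm_space \<Longrightarrow> f \<circ> \<phi> \<in> norm_space"
    and comp: "compactin met.mtopology (met.mtopology closure_of ((\<lambda>f. f \<circ> \<phi>) ` {f. N f \<le> 1}))"
  shows "vanishing \<phi>"
  unfolding vanishing_def
proof (intro allI impI, elim conjE exE)
  fix F :: "nat \<Rightarrow> 'v \<Rightarrow> complex" and K0 :: real
  assume K0: "\<forall>n. N (F n) \<le> ennreal K0" and F0: "\<forall>v. (\<lambda>n. F n v) \<longlonglongrightarrow> 0"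
  let ?S = "(\<lambda>f. f \<circ> \<phi>) ` {f. N f \<le> 1}"
  \<comment> \<open>\<open>K0\<close> may be zero or negative; a positive bound is needed to divide
    by it.\<close>
  define K where "K = max K0 1"
  have "K > 0" by (simp add: K_def)
  have K: "N (F n) \<le> ennreal K" for n
    using K0 order_trans unfolding K_def by (metis ennreal_leI max.cobounded1)
  define G where "G n = (\<lambda>v. complex_of_real (1 / K) * F n v)" for n
  have G1: "N (G n) \<le> 1" for n
  proof -
    have "N (G n) = ennreal (1 / K) * N (F n)"
      unfolding G_def scale using \<open>K > 0\<close> by (simp del: of_real_divide)
    also have "\<dots> \<le> ennreal (1 / K) * ennreal K" using K by (intro mult_left_mono) auto
    also have "\<dots> = 1" using \<open>K > 0\<close> by (simp flip: ennreal_mult)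
    finally show ?thesis .
  qed
  have Gc: "G n \<circ> \<phi> \<in> norm_space" for n
  proof (rule bdd)
    have "N (G n) < \<infinity>" using G1[of n] by (simp add: order_le_less_trans)
    then show "G n \<in> norm_space" by (simp add: norm_space_def)
  qed
  have G0: "(\<lambda>n. (G n \<circ> \<phi>) v) \<longlonglongrightarrow> 0" for v
    using tendsto_mult_left[OF F0[rule_format, of "\<phi> v"], of "complex_of_real (1 / K)"]
    by (simp add: G_def)
  have GF: "N (F n \<circ> \<phi>) = ennreal K * N (G n \<circ> \<phi>)" for n
    using scale[of "complex_of_real K" "G n \<circ> \<phi>"] \<open>K > 0\<close> by (simp add: G_def o_def)
  have "?S \<inter> norm_space \<subseteq> met.mtopology closure_of ?S"
    using closure_of_subset_Int[of met.mtopology ?S] by (simp add: Int_commute)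
  then have cl: "G n \<circ> \<phi> \<in> met.mtopology closure_of ?S" for n
    using G1 Gc by blast
  have sub: "\<exists>t. strict_mono t \<and> (\<lambda>n. N (G (s (t n)) \<circ> \<phi>)) \<longlonglongrightarrow> 0"
    if "strict_mono s" for s :: "nat \<Rightarrow> nat"
  proof -
    have "range (\<lambda>n. G (s n) \<circ> \<phi>) \<subseteq> met.mtopology closure_of ?S" using cl by auto
    then obtain l t where l: "l \<in> met.mtopology closure_of ?S" and t: "strict_mono t"
      and lim: "limitin met.mtopology ((\<lambda>n. G (s n) \<circ> \<phi>) \<circ> t) l sequentially"
      using comp unfolding met.compactin_sequentially by blast
    have lc: "l \<in> norm_space" using lim by (simp add: met.limitin_mspace)
    have *: "(\<lambda>n. N (\<lambda>v. (G (s (t n)) \<circ> \<phi>) v - l v)) \<longlonglongrightarrow> 0"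
      using lim Gc lc by (subst (asm) limitin_iff) (auto simp: o_def)
    have "l v = 0" for v
    proof -
      have "(\<lambda>n. (G (s (t n)) \<circ> \<phi>) v - l v) \<longlonglongrightarrow> 0"
        by (rule pointwise_tendsto_0[OF *])
      then have "(\<lambda>n. (G (s (t n)) \<circ> \<phi>) v) \<longlonglongrightarrow> l v" by (rule LIM_zero_cancel)
      moreover have "(\<lambda>n. (G (s (t n)) \<circ> \<phi>) v) \<longlonglongrightarrow> 0"
        using LIMSEQ_subseq_LIMSEQ[OF G0 strict_mono_o[OF that t]] by (simp add: o_def)
      ultimately show ?thesis by (rule LIMSEQ_unique)
    qed
    then show ?thesis using * t by (auto simp: o_def)
  qed
  have "(\<lambda>n. N (G n \<circ> \<phi>)) \<longlonglongrightarrow> 0"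
  \<comment> \<open>Subsequence principle: without convergence, infinitely many norms stay at or
    above some \<open>e\<close>. Enumerating their indices gives a subsequence that contradicts
    \<open>sub\<close>.\<close>
  proof (rule ccontr)
    assume "\<not> ?thesis"
    then obtain e where e: "e > 0" "\<not> eventually (\<lambda>n. N (G n \<circ> \<phi>) < e) sequentially"
      unfolding order_tendsto_iff by auto
    then have "\<exists>\<^sub>F n in sequentially. \<not> N (G n \<circ> \<phi>) < e"
      by (simp add: frequently_def)
    then have inf: "infinite {n. \<not> N (G n \<circ> \<phi>) < e}"
      by (simp add: frequently_cofinite flip: cofinite_eq_sequentially)
    define s where "s = enumerate {n. \<not> N (G n \<circ> \<phi>) < e}"
    have "strict_mono s" unfolding s_def by (rule strict_mono_enumerate[OF inf])
    from sub[OF this] obtain t where "(\<lambda>n. N (G (s (t n)) \<circ> \<phi>)) \<longlonglongrightarrow> 0" by blast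
    then have "eventually (\<lambda>n. N (G (s (t n)) \<circ> \<phi>) < e) sequentially"
      using e(1) by (rule order_tendstoD)
    then obtain n where "N (G (s (t n)) \<circ> \<phi>) < e" by (auto simp: eventually_sequentially)
    moreover have "s (t n) \<in> {n. \<not> N (G n \<circ> \<phi>) < e}"
      unfolding s_def by (rule enumerate_in_set[OF inf])
    ultimately show False by simp
  qed
  then have "(\<lambda>n. ennreal K * N (G n \<circ> \<phi>)) \<longlonglongrightarrow> ennreal K * 0"
    by (intro tendsto_mult_ennreal tendsto_const) auto
  then show "(\<lambda>n. N (F n \<circ> \<phi>)) \<longlonglongrightarrow> 0" by (simp add: GF)
qed

end

subsection \<open>Paths and levels in a homogeneous tree\<close>

text \<open>
  If two paths separate at \<open>a\<close> and the first vertex of one branch lying on the other branch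
  is \<open>z\<close>, then the two arcs between \<open>a\<close> and \<open>z\<close> form a cycle.
\<close>

lemma graph_path_unique:
  assumes sym: "symp adj" and acyc: "\<nexists>xs. graph_cycle adj xs"
    and p: "graph_path adj u xs v" and p': "graph_path adj u ys v"
  shows "xs = ys"
proof (rule ccontr)
  assume "xs \<noteq> ys"
  obtain ps xs' ys' where dec: "xs = ps @ xs'" "ys = ps @ ys'"
      "xs' = [] \<or> ys' = [] \<or> hd xs' \<noteq> hd ys'"
    using longest_common_prefix[of xs ys] by metis
  have "xs \<noteq> []" "ys \<noteq> []" "hd xs = hd ys" and lst: "last xs = last ys"
    and d: "distinct xs" "distinct ys" and s: "successively adj xs" "successively adj ys"
    using p p' by (auto simp: graph_path_def)
  then have ps: "ps \<noteq> []" using dec by auto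
  \<comment> \<open>Neither path is a proper prefix of the other, since the common endpoint would
    then occur twice on the longer one.\<close>
  have ne: "xs' \<noteq> []" "ys' \<noteq> []"
  proof -
    show "xs' \<noteq> []"
    proof
      assume "xs' = []"
      then have "ys' \<noteq> []" using dec \<open>xs \<noteq> ys\<close> by auto
      then have "last ps \<in> set ys'" using dec lst \<open>xs' = []\<close> by (metis append_Nil2 last_appendR last_in_set)
      then show False using d(2) dec(2) ps by (auto simp: disjoint_iff)
    qed
    show "ys' \<noteq> []"
    proof
      assume "ys' = []"
      then have "xs' \<noteq> []" using dec \<open>xs \<noteq> ys\<close> by auto
      then have "last ps \<in> set xs'" using dec lst \<open>ys' = []\<close> by (metis append_Nil2 last_appendR last_in_set)
      then show False using d(1) dec(1) ps by (auto simp: disjoint_iff)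
    qed
  qed
  then have hd: "hd xs' \<noteq> hd ys'" using dec(3) by simp
  define a where "a = last ps"
  have "last xs' = last ys'" using lst dec ne by simp
  then have "\<exists>z\<in>set xs'. z \<in> set ys'" using ne last_in_set by metis
  \<comment> \<open>Taking the first meeting vertex makes \<open>P\<close> disjoint from the other
    branch, so the closed walk formed from \<open>P\<close> and \<open>R\<close> repeats no
    vertex.\<close>
  then obtain P z Q where P: "xs' = P @ z # Q" "z \<in> set ys'" "\<forall>y\<in>set P. y \<notin> set ys'"
    using split_list_first_prop[of xs' "\<lambda>z. z \<in> set ys'"] by blast
  obtain R S where R: "ys' = R @ z # S" "z \<notin> set R"
    using split_list_first[OF P(2)] by blast
  have sx: "successively adj (a # P @ [z])"
  proof -
    have "xs = butlast ps @ (a # P @ [z]) @ Q" using dec(1) P(1) ps by (simp add: a_def)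
    then show ?thesis using s(1) by (metis successively_append_iff)
  qed
  have sy: "successively adj (a # R @ [z])"
  proof -
    have "ys = butlast ps @ (a # R @ [z]) @ S" using dec(2) R(1) ps by (simp add: a_def)
    then show ?thesis using s(2) by (metis successively_append_iff)
  qed
  \<comment> \<open>Symmetry lets the second arc be traversed backwards, from \<open>z\<close> to
    \<open>a\<close>.\<close>
  have flip: "(\<lambda>x y. adj y x) = adj" using sym by (auto simp: symp_def fun_eq_iff)
  have "successively adj (rev (a # R @ [z]))"
    unfolding successively_rev flip by (rule sy)
  then have sy': "successively adj (z # rev R @ [a])" by simp
  let ?c = "a # P @ z # rev R"
  have "a \<notin> set xs'" "a \<notin> set ys'" using d dec ps by (auto simp: a_def disjoint_iff)
  moreover have "set P \<inter> set R = {}" "z \<notin> set P" using P R by auto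
  moreover have "distinct P" "distinct R" using d dec P R by auto
  ultimately have "distinct ?c" using P(1) R by auto
  moreover have "successively adj ?c"
    using sx sy' successively_append_iff[of adj "a # P" "[z]"]
      successively_append_iff[of adj "a # P" "z # rev R"] successively_append_iff[of adj "z # rev R" "[a]"]
    by simp
  moreover have "adj (last ?c) (hd ?c)"
    using sy' by (cases R) (auto simp: successively_append_iff successively_Cons)
  moreover have "length ?c \<ge> 3"
  proof -
    \<comment> \<open>If both were empty, both branches would start with \<open>z\<close>, although
      their heads differ.\<close>
    have "P \<noteq> [] \<or> R \<noteq> []" using hd P(1) R(1) by auto
    then show ?thesis by (cases P; cases R) auto
  qed
  ultimately show False using acyc by (auto simp: graph_cycle_def)
qed

section \<open>Levels of the tree: finite, nonempty, and covering it\<close>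

lemma tree_level_eqI:
  assumes "homogeneous_tree q adj" "graph_path adj r xs v"
  shows "tree_level adj r v = length xs - 1"
proof -
  have "(THE xs. graph_path adj r xs v) = xs"
    using assms by (intro the_equality graph_path_unique[of adj]) (auto simp: homogeneous_tree_def)
  then show ?thesis by (simp add: tree_level_def)
qed

lemma tree_level_0_iff:
  assumes "homogeneous_tree q adj"
  shows "tree_level adj r v = 0 \<longleftrightarrow> v = r"
proof -
  obtain xs where xs: "graph_path adj r xs v"
    using assms unfolding homogeneous_tree_def by blast
  have "tree_level adj r v = length xs - 1" by (rule tree_level_eqI[OF assms xs])
  then show ?thesis using xs by (cases xs) (auto simp: graph_path_def split: if_splits)
qed

text \<open>Deleting the last vertex of the path to \<open>v\<close> leaves a path from the root to
  its predecessor. Hence levels grow only through neighbours, and none is skipped.\<close>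

lemma tree_level_Suc:
  assumes "homogeneous_tree q adj" "tree_level adj r v = Suc n"
  shows "\<exists>w. tree_level adj r w = n \<and> adj w v"
proof -
  obtain xs where xs: "graph_path adj r xs v"
    using assms(1) unfolding homogeneous_tree_def by blast
  \<comment> \<open>A path with \<open>Suc n\<close> edges lists one vertex more.\<close>
  have len: "length xs = Suc (Suc n)"
    using tree_level_eqI[OF assms(1) xs] assms(2) xs by (auto simp: graph_path_def)
  then have "xs \<noteq> []" by auto
  then have dec: "xs = butlast xs @ [v]" using xs by (metis append_butlast_last_id graph_path_def)
  have ne: "butlast xs \<noteq> []" using len by (metis diff_Suc_1 length_butlast length_0_conv nat.distinct(1))
  have d: "distinct (butlast xs @ [v])" "successively adj (butlast xs @ [v])" "hd (butlast xs @ [v]) = r"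
    using xs dec by (auto simp: graph_path_def)
  have "graph_path adj r (butlast xs) (last (butlast xs))"
    using d ne by (auto simp: graph_path_def successively_append_iff)
  from tree_level_eqI[OF assms(1) this] have "tree_level adj r (last (butlast xs)) = n"
    using len by simp
  moreover have "adj (last (butlast xs)) v"
    using d(2) ne by (auto simp: successively_append_iff)
  ultimately show ?thesis by blast
qed

lemma finite_tree_level:
  assumes "homogeneous_tree q adj"
  shows "finite {v. tree_level adj r v = n}"
proof (induction n)
  case 0
  show ?case by (simp add: tree_level_0_iff[OF assms])
next
  case (Suc n)
  have "card {w. adj v w} = q + 1" for v
    using assms by (auto simp: homogeneous_tree_def)
  \<comment> \<open>An infinite set has \<open>card\<close> 0, which is not
    \<open>q + 1\<close>.\<close>
  then have "finite {w. adj v w}" for v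
    by (metis Suc_eq_plus1 card.infinite nat.distinct(1))
  then have "finite (\<Union>v\<in>{v. tree_level adj r v = n}. {w. adj v w})"
    using Suc by blast
  moreover have "{v. tree_level adj r v = Suc n} \<subseteq> (\<Union>v\<in>{v. tree_level adj r v = n}. {w. adj v w})"
    using tree_level_Suc[OF assms] by fastforce
  ultimately show ?case by (rule rev_finite_subset)
qed

text \<open>An empty level would make all later ones empty, so the tree would be a finite union of
  finite levels. This gives meaning to the \<open>Max\<close> in \<open>tree_mean\<close>.\<close>

lemma tree_level_nonempty:
  assumes "homogeneous_tree q adj"
  shows "{v. tree_level adj r v = n} \<noteq> {}"
proof
  assume n: "{v. tree_level adj r v = n} = {}"
  have "{v. tree_level adj r v = n + k} = {}" for k
    using n by (induction k) (auto dest: tree_level_Suc[OF assms])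
  then have "tree_level adj r v < n" for v
    by (metis (mono_tags, lifting) empty_Collect_eq le_add_diff_inverse not_le)
  then have "(UNIV :: 'a set) \<subseteq> (\<Union>k<n. {v. tree_level adj r v = k})" by auto
  moreover have "finite (\<Union>k<n. {v. tree_level adj r v = k})"
    using finite_tree_level[OF assms] by blast
  ultimately have "finite (UNIV :: 'a set)" by (rule finite_subset)
  then show False using assms by (simp add: homogeneous_tree_def)
qed

lemma countable_tree:
  fixes adj :: "'v \<Rightarrow> 'v \<Rightarrow> bool"
  assumes "homogeneous_tree q adj"
  shows "countable (UNIV :: 'v set)"
proof -
  \<comment> \<open>Any root serves for counting; \<open>undefined\<close> is an arbitrary
    vertex.\<close>
  have "(UNIV :: 'v set) = (\<Union>n. {v. tree_level adj undefined v = n})" by auto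
  moreover have "countable \<dots>"
    using finite_tree_level[OF assms] by (intro countable_UN) (auto intro: countable_finite)
  ultimately show ?thesis by simp
qed

subsection \<open>Minkowski's inequality\<close>

text \<open>Two positive arguments are covered by \<open>powr_convex\<close>. If one argument is 0,
  the claim reduces to \<open>le\<close>, that is, to \<open>c powr p \<le> c\<close> for
  \<open>c\<close> between 0 and 1.\<close>

lemma convex_on_powr_nonneg:
  fixes p :: real
  assumes "1 \<le> p"
  shows "convex_on {0..} (\<lambda>x. x powr p)"
proof (rule convex_onI)
  fix t x y :: real
  assume t: "0 < t" "t < 1" and xy: "x \<in> {0..}" "y \<in> {0..}"
  have le: "(c * z) powr p \<le> c * z powr p" if "0 < c" "c < 1" "0 \<le> z" for c z :: real
  proof -
    have "c powr p \<le> c powr 1" using that assms by (intro powr_mono') auto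
    then show ?thesis using that by (simp add: powr_mult mult_right_mono)
  qed
  show "((1 - t) *\<^sub>R x + t *\<^sub>R y) powr p \<le> (1 - t) * x powr p + t * y powr p"
  proof (cases "x = 0 \<or> y = 0")
    case True
    then show ?thesis using le[of t y] le[of "1 - t" x] t xy assms by auto
  next
    case False
    then show ?thesis
      using convex_onD[OF powr_convex[OF assms], of t x y] t xy by auto
  qed
qed auto

text \<open>Convexity of the power, applied to \<open>f\<close> and \<open>g\<close> divided by
  bounds for their norms, replaces the usual route through Hoelder. The weight \<open>c\<close> is
  the normalising factor of a level.\<close>

lemma Minkowski_sum:
  fixes f g :: "'a \<Rightarrow> 'b :: real_normed_vector" and p c :: real
  assumes p: "1 \<le> p" and c: "0 \<le> c"
  shows "(c * (\<Sum>v\<in>S. norm (f v + g v) powr p)) powr (1 / p)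
    \<le> (c * (\<Sum>v\<in>S. norm (f v) powr p)) powr (1 / p) + (c * (\<Sum>v\<in>S. norm (g v) powr p)) powr (1 / p)"
    (is "?L \<le> ?A + ?B")
proof (rule field_le_epsilon)
  fix e :: real assume e: "e > 0"
  \<comment> \<open>The summand \<open>e / 2\<close> keeps the divisors positive even when a norm
    vanishes.\<close>
  define a where "a = ?A + e / 2"
  define b where "b = ?B + e / 2"
  have pos: "a > 0" "b > 0" using e by (auto simp: a_def b_def add_nonneg_pos)
  have bound: "c * (\<Sum>v\<in>S. norm (h v) powr p) \<le> d powr p"
    if "(c * (\<Sum>v\<in>S. norm (h v) powr p)) powr (1 / p) \<le> d" for h :: "'a \<Rightarrow> 'b" and d
  proof -
    have "0 \<le> c * (\<Sum>v\<in>S. norm (h v) powr p)" using c by (simp add: sum_nonneg)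
    then have "c * (\<Sum>v\<in>S. norm (h v) powr p) = ((c * (\<Sum>v\<in>S. norm (h v) powr p)) powr (1 / p)) powr p"
      using p by (simp add: powr_powr)
    also have "\<dots> \<le> d powr p" using that p by (intro powr_mono2) auto
    finally show ?thesis .
  qed
  have fa: "c * (\<Sum>v\<in>S. norm (f v) powr p) \<le> a powr p"
    using e by (intro bound) (simp add: a_def)
  have gb: "c * (\<Sum>v\<in>S. norm (g v) powr p) \<le> b powr p"
    using e by (intro bound) (simp add: b_def)
  define t where "t = b / (a + b)"
  have t: "0 \<le> t" "t \<le> 1" "1 - t = a / (a + b)" using pos by (auto simp: t_def field_simps)
  \<comment> \<open>write \<open>|f| + |g|\<close> as \<open>a + b\<close> times a convex combination of \<open>|f| / a\<close> and \<open>|g| / b\<close>\<close>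
  have summand: "norm (f v + g v) powr p \<le>
      (a + b) powr p * ((1 - t) * (norm (f v) powr p / a powr p) + t * (norm (g v) powr p / b powr p))" for v
  proof -
    have "(1 - t) * (norm (f v) / a) = norm (f v) / (a + b)" "t * (norm (g v) / b) = norm (g v) / (a + b)"
      unfolding t(3) using pos by (auto simp: t_def)
    then have "norm (f v) + norm (g v) = (a + b) * ((1 - t) * (norm (f v) / a) + t * (norm (g v) / b))"
      using pos by (simp flip: add_divide_distrib)
    then have "norm (f v + g v) powr p \<le> ((a + b) * ((1 - t) * (norm (f v) / a) + t * (norm (g v) / b))) powr p"
      using p norm_triangle_ineq[of "f v" "g v"] by (intro powr_mono2) auto
    also have "\<dots> = (a + b) powr p * ((1 - t) * (norm (f v) / a) + t * (norm (g v) / b)) powr p"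
      using pos t by (intro powr_mult)
    also have "\<dots> \<le> (a + b) powr p * ((1 - t) * (norm (f v) / a) powr p + t * (norm (g v) / b) powr p)"
      using convex_onD[OF convex_on_powr_nonneg[OF p], of t "norm (f v) / a" "norm (g v) / b"] pos t
      by (intro mult_left_mono) auto
    finally show ?thesis using pos by (simp add: powr_divide)
  qed
  have "c * (\<Sum>v\<in>S. norm (f v + g v) powr p) \<le> c * (\<Sum>v\<in>S. (a + b) powr p *
      ((1 - t) * (norm (f v) powr p / a powr p) + t * (norm (g v) powr p / b powr p)))"
    using c by (intro mult_left_mono sum_mono summand)
  also have "\<dots> = (a + b) powr p * ((1 - t) * ((c * (\<Sum>v\<in>S. norm (f v) powr p)) / a powr p)
      + t * ((c * (\<Sum>v\<in>S. norm (g v) powr p)) / b powr p))"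
    by (simp add: sum.distrib sum_distrib_left sum_divide_distrib algebra_simps)
  also have "\<dots> \<le> (a + b) powr p * ((1 - t) * 1 + t * 1)"
    using fa gb pos t by (intro mult_left_mono add_mono) auto
  finally have "c * (\<Sum>v\<in>S. norm (f v + g v) powr p) \<le> (a + b) powr p" by simp
  then have "?L \<le> ((a + b) powr p) powr (1 / p)"
    using p c by (intro powr_mono2) (auto intro!: mult_nonneg_nonneg sum_nonneg)
  also have "\<dots> = ?A + ?B + e" using p pos by (simp add: powr_powr a_def b_def)
  finally show "?L \<le> ?A + ?B + e" .
qed

subsection \<open>The tree norm\<close>

lemma one_le_enn2real:
  assumes "1 \<le> (p :: ennreal)" "p \<noteq> \<infinity>"
  shows "1 \<le> enn2real p"
  using enn2real_mono[of 1 p] assms by (simp add: less_top)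

lemma tree_mean_nonneg:
  assumes "homogeneous_tree q adj"
  shows "0 \<le> tree_mean q adj r p n f"
proof -
  obtain v where "tree_level adj r v = n" using tree_level_nonempty[OF assms] by blast
  then have "0 \<le> Max ((\<lambda>v. cmod (f v)) ` {v. tree_level adj r v = n})"
    using finite_tree_level[OF assms] by (intro Max_ge_iff[THEN iffD2]) auto
  then show ?thesis by (simp add: tree_mean_def)
qed

lemma tree_mean_scale:
  assumes "homogeneous_tree q adj" "1 \<le> p"
  shows "tree_mean q adj r p n (\<lambda>v. c * f v) = cmod c * tree_mean q adj r p n f"
proof -
  note lev = finite_tree_level[OF assms(1)] tree_level_nonempty[OF assms(1)]
  consider "n = 0" | "n \<noteq> 0" "p = \<infinity>" | "n \<noteq> 0" "p \<noteq> \<infinity>" by blast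
  then show ?thesis
  proof cases
    case 2
    \<comment> \<open>A monotone map commutes with \<open>Max\<close> over a finite nonempty
      set.\<close>
    have "mono ((*) (cmod c))" by (intro monoI mult_left_mono) auto
    from mono_Max_commute[OF this, of "(\<lambda>v. cmod (f v)) ` {v. tree_level adj r v = n}"]
    show ?thesis using 2 lev by (simp add: tree_mean_def norm_mult image_image)
  next
    case 3
    define a where "a = enn2real p"
    define w where "w = 1 / ((real q + 1) * real q ^ (n - 1))"
    let ?S = "\<Sum>v | tree_level adj r v = n. cmod (f v) powr a"
    have a: "1 \<le> a" unfolding a_def using one_le_enn2real assms(2) 3 by blast
    have "w * (\<Sum>v | tree_level adj r v = n. cmod (c * f v) powr a) = cmod c powr a * (w * ?S)"
      by (simp add: norm_mult powr_mult sum_distrib_left mult_ac)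
    moreover have "(cmod c powr a * (w * ?S)) powr (1 / a) = cmod c * (w * ?S) powr (1 / a)"
    proof -
      have "0 \<le> w * ?S" by (simp add: w_def sum_nonneg)
      then show ?thesis using a by (subst powr_mult) (auto simp: powr_powr)
    qed
    ultimately have "(w * (\<Sum>v | tree_level adj r v = n. cmod (c * f v) powr a)) powr (1 / a)
        = cmod c * (w * ?S) powr (1 / a)" by (simp only:)
    then show ?thesis using 3 by (simp add: tree_mean_def a_def w_def)
  qed (simp add: tree_mean_def norm_mult)
qed

lemma tree_mean_triangle:
  assumes "homogeneous_tree q adj" "1 \<le> p"
  shows "tree_mean q adj r p n (\<lambda>v. f v + g v) \<le> tree_mean q adj r p n f + tree_mean q adj r p n g"
proof -
  note lev = finite_tree_level[OF assms(1)] tree_level_nonempty[OF assms(1)]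
  consider "n = 0" | "n \<noteq> 0" "p = \<infinity>" | "n \<noteq> 0" "p \<noteq> \<infinity>" by blast
  then show ?thesis
  proof cases
    case 2
    have "cmod (f v + g v) \<le> Max ((\<lambda>v. cmod (f v)) ` {v. tree_level adj r v = n})
        + Max ((\<lambda>v. cmod (g v)) ` {v. tree_level adj r v = n})" if "tree_level adj r v = n" for v
      using that lev by (intro norm_triangle_ineq[THEN order_trans] add_mono Max_ge) auto
    then show ?thesis using 2 lev by (simp add: tree_mean_def)
  next
    case 3
    then show ?thesis
      unfolding tree_mean_def
      using Minkowski_sum[OF one_le_enn2real[OF assms(2) 3(2)],
          of "1 / ((real q + 1) * real q ^ (n - 1))" f g "{v. tree_level adj r v = n}"] by simp
  qed (simp add: tree_mean_def norm_triangle_ineq)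
qed

text \<open>One term is at most the maximum or the sum over its level. For finite \<open>p\<close>,
  the constant undoes the weight \<open>w\<close> of that level.\<close>

lemma tree_mean_eval:
  assumes "q \<ge> 1" "homogeneous_tree q adj" "1 \<le> p"
  shows "\<exists>C>0. \<forall>f. cmod (f v) \<le> C * tree_mean q adj r p (tree_level adj r v) f"
proof -
  define n where "n = tree_level adj r v"
  note lev = finite_tree_level[OF assms(2)]
  consider "n = 0" | "n \<noteq> 0" "p = \<infinity>" | "n \<noteq> 0" "p \<noteq> \<infinity>" by blast
  then show ?thesis
  proof cases
    case 1
    then have "v = r" using tree_level_0_iff[OF assms(2)] by (simp add: n_def)
    then show ?thesis using 1 by (intro exI[of _ 1]) (simp add: tree_mean_def n_def)
  next
    case 2
    then show ?thesis using lev by (intro exI[of _ 1]) (auto simp: tree_mean_def n_def intro!: Max_ge)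
  next
    case 3
    define a where "a = enn2real p"
    define w where "w = 1 / ((real q + 1) * real q ^ (n - 1))"
    \<comment> \<open>Here \<open>q \<ge> 1\<close> keeps the denominator from being 0.\<close>
    have w: "w > 0" using assms(1) by (simp add: w_def)
    have a: "1 \<le> a" unfolding a_def using one_le_enn2real assms(3) 3 by blast
    have "cmod (f v) \<le> (1 / w powr (1 / a)) * tree_mean q adj r p n f" for f
    proof -
      let ?S = "\<Sum>v | tree_level adj r v = n. cmod (f v) powr a"
      have "cmod (f v) powr a \<le> ?S"
        using lev by (intro member_le_sum) (auto simp: n_def)
      then have "(cmod (f v) powr a) powr (1 / a) \<le> ?S powr (1 / a)"
        using a by (intro powr_mono2) auto
      then have "cmod (f v) \<le> ?S powr (1 / a)" using a by (simp add: powr_powr)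
      also have "\<dots> = (1 / w powr (1 / a)) * (w * ?S) powr (1 / a)"
        using w by (simp add: powr_mult sum_nonneg)
      finally show ?thesis using 3 by (simp add: tree_mean_def a_def w_def)
    qed
    then show ?thesis using w by (intro exI[of _ "1 / w powr (1 / a)"]) (simp add: n_def)
  qed
qed

text \<open>A level is finite, so its mean involves only finitely many values and pointwise limits
  suffice.\<close>

lemma tree_mean_pointwise_limit_le:
  assumes tree: "homogeneous_tree q adj" and p: "1 \<le> p"
    and le: "\<And>k :: nat. tree_mean q adj r p n (F k) \<le> B" and lim: "\<And>v. (\<lambda>k. F k v) \<longlonglongrightarrow> f v"
  shows "tree_mean q adj r p n f \<le> B"
proof -
  note lev = finite_tree_level[OF tree] tree_level_nonempty[OF tree]
  consider "n = 0" | "n \<noteq> 0" "p = \<infinity>" | "n \<noteq> 0" "p \<noteq> \<infinity>" by blast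
  then show ?thesis
  proof cases
    case 1
    then show ?thesis
      using le LIMSEQ_le_const2[OF tendsto_norm[OF lim]] by (simp add: tree_mean_def)
  next
    case 2
    have "cmod (f v) \<le> B" if "tree_level adj r v = n" for v
    proof (rule LIMSEQ_le_const2[OF tendsto_norm[OF lim]])
      have "cmod (F k v) \<le> B" for k using le[of k] 2 lev that by (simp add: tree_mean_def)
      then show "\<exists>N. \<forall>k\<ge>N. cmod (F k v) \<le> B" by blast
    qed
    then show ?thesis using 2 lev by (simp add: tree_mean_def)
  next
    case 3
    have a: "1 \<le> enn2real p" using one_le_enn2real p 3 by blast
    \<comment> \<open>The limit value may be 0; there \<open>tendsto_powr'\<close> needs a positive
      exponent and nonnegative bases.\<close>
    have pw: "(\<lambda>k. cmod (F k v) powr enn2real p) \<longlonglongrightarrow> cmod (f v) powr enn2real p" for v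
      using a by (intro tendsto_powr' tendsto_norm lim tendsto_const) auto
    have "(\<lambda>k. tree_mean q adj r p n (F k)) \<longlonglongrightarrow> tree_mean q adj r p n f"
      unfolding tree_mean_def using 3 a
      by (simp only: if_False, intro tendsto_powr' tendsto_mult tendsto_sum pw tendsto_const)
        (auto intro!: always_eventually divide_nonneg_nonneg sum_nonneg)
    then show ?thesis by (rule LIMSEQ_le_const2) (use le in blast)
  qed
qed

text \<open>Each inequality is proved level by level and then passed to the supremum. Nonnegativity
  of the means matters because \<open>ennreal\<close> truncates negative reals to 0.\<close>

lemma function_norm_tree_norm:
  fixes adj :: "'v \<Rightarrow> 'v \<Rightarrow> bool"
  assumes q: "q \<ge> 1" and tree: "homogeneous_tree q adj" and p: "1 \<le> p"
  shows "function_norm (tree_norm q adj r p)"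
proof
  show "countable (UNIV :: 'v set)" using countable_tree[OF tree] .
next
  fix c :: complex and f :: "'v \<Rightarrow> complex"
  show "tree_norm q adj r p (\<lambda>v. c * f v) = ennreal (cmod c) * tree_norm q adj r p f"
    unfolding tree_norm_def
    by (simp add: tree_mean_scale[OF tree p] ennreal_mult tree_mean_nonneg[OF tree] SUP_mult_left_ennreal)
next
  fix f g :: "'v \<Rightarrow> complex"
  show "tree_norm q adj r p (\<lambda>v. f v + g v) \<le> tree_norm q adj r p f + tree_norm q adj r p g"
    unfolding tree_norm_def
  proof (rule SUP_least)
    fix n
    have "ennreal (tree_mean q adj r p n (\<lambda>v. f v + g v))
        \<le> ennreal (tree_mean q adj r p n f) + ennreal (tree_mean q adj r p n g)"
      using tree_mean_triangle[OF tree p] tree_mean_nonneg[OF tree]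
      by (simp add: ennreal_leI flip: ennreal_plus)
    also have "\<dots> \<le> (SUP n. ennreal (tree_mean q adj r p n f)) + (SUP n. ennreal (tree_mean q adj r p n g))"
      by (intro add_mono SUP_upper) auto
    finally show "ennreal (tree_mean q adj r p n (\<lambda>v. f v + g v)) \<le> \<dots>" .
  qed
next
  fix v :: 'v
  obtain C where C: "C > 0" "\<And>f. cmod (f v) \<le> C * tree_mean q adj r p (tree_level adj r v) f"
    using tree_mean_eval[OF q tree p] by blast
  have "ennreal (cmod (f v)) \<le> ennreal C * tree_norm q adj r p f" for f
  proof -
    have "ennreal (cmod (f v)) \<le> ennreal C * ennreal (tree_mean q adj r p (tree_level adj r v) f)"
      using C tree_mean_nonneg[OF tree] by (simp add: ennreal_leI flip: ennreal_mult)
    also have "\<dots> \<le> ennreal C * tree_norm q adj r p f"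
      unfolding tree_norm_def by (intro mult_left_mono SUP_upper) auto
    finally show ?thesis .
  qed
  then show "\<exists>C>0. \<forall>f. ennreal (cmod (f v)) \<le> ennreal C * tree_norm q adj r p f"
    using C(1) by blast
next
  fix F :: "nat \<Rightarrow> 'v \<Rightarrow> complex" and B f
  assume le: "\<And>k. tree_norm q adj r p (F k) \<le> B" and lim: "\<And>v. (\<lambda>k. F k v) \<longlonglongrightarrow> f v"
  show "tree_norm q adj r p f \<le> B"
  proof (cases B)
    case (real b)
    have "ennreal (tree_mean q adj r p n (F k)) \<le> ennreal b" for n k
      using le[of k] real by (auto simp: tree_norm_def SUP_le_iff)
    then have "tree_mean q adj r p n (F k) \<le> b" for n k using real by simp
    then show ?thesis
      unfolding tree_norm_def real
      by (intro SUP_least ennreal_leI tree_mean_pointwise_limit_le[OF tree p _ lim])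
  qed simp
qed

theorem theorem7:
  fixes q :: nat
    and adj :: "'v \<Rightarrow> 'v \<Rightarrow> bool"
    and r :: 'v
    and \<phi> :: "'v \<Rightarrow> 'v"
    and p :: ennreal
  assumes "q \<ge> 1"
    and "homogeneous_tree q adj"
    and "1 \<le> p"
  shows "compact_operator_on_tree_space q adj r p (composition_operator \<phi>) \<longleftrightarrow>
    (\<forall>F :: nat \<Rightarrow> 'v \<Rightarrow> complex.
       (\<exists>K::real. \<forall>n. tree_norm q adj r p (F n) \<le> ennreal K) \<and>
       (\<forall>v. (\<lambda>n. F n v) \<longlonglongrightarrow> 0) \<longrightarrow>
       (\<lambda>n. tree_norm q adj r p (composition_operator \<phi> (F n))) \<longlonglongrightarrow> 0)"
proof -
  \<comment> \<open>Under this interpretation the abstract space and metric unfold to those of the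
    tree, leaving only the equivalence with \<open>vanishing\<close>.\<close>
  interpret function_norm "tree_norm q adj r p"
    using function_norm_tree_norm[OF assms] .
  have norm_space: "tree_space q adj r p = norm_space" by (simp add: tree_space_def norm_space_def)
  have top: "tree_topology q adj r p = met.mtopology"
  proof -
    have "tree_dist q adj r p = norm_dist" by (simp add: tree_dist_def norm_dist_def fun_eq_iff)
    then show ?thesis by (simp add: tree_topology_def norm_space)
  qed
  have comp: "composition_operator \<phi> = (\<lambda>f. f \<circ> \<phi>)"
    by (simp add: composition_operator_def fun_eq_iff)
  have "compact_operator_on_tree_space q adj r p (\<lambda>f. f \<circ> \<phi>) \<longleftrightarrow> vanishing \<phi>"
  proof
    assume "compact_operator_on_tree_space q adj r p (\<lambda>f. f \<circ> \<phi>)"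
    then show "vanishing \<phi>"
      unfolding compact_operator_on_tree_space_def bounded_operator_on_tree_space_def norm_space top
      by (intro compact_imp_vanishing) auto
  next
    assume van: "vanishing \<phi>"
    obtain K where K: "\<And>f. f \<in> norm_space \<Longrightarrow> tree_norm q adj r p (f \<circ> \<phi>) \<le> ennreal K * tree_norm q adj r p f"
      using vanishing_imp_bounded[OF van] by blast
    have "f \<circ> \<phi> \<in> norm_space" if "f \<in> norm_space" for f
      using K[OF that] that
      by (auto simp: norm_space_def ennreal_mult_less_top intro: order_le_less_trans)
    then have "bounded_operator_on_tree_space q adj r p (\<lambda>f. f \<circ> \<phi>)"
      unfolding bounded_operator_on_tree_space_def norm_space using K by (auto simp: o_def)
    then show "compact_operator_on_tree_space q adj r p (\<lambda>f. f \<circ> \<phi>)"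
      unfolding compact_operator_on_tree_space_def top using vanishing_imp_compact[OF van] by simp
  qed
  then show ?thesis by (simp add: comp vanishing_def)
qed

end
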